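(* Let $a<b$, let $\nu$ be a Borel probability measure on $[a,b]$ that admits a density with respect to the Lebesgue measure, and let $k \in C^\infty([a,b]^2)$ be a positive-definite kernel that is totally positive of order $2$. Let $n\in\mathbb{N}$ and suppose that the point set $X \in \mathcal{S}^n$ is locally optimal. Then all the Bayesian quadrature weights $w_{X,1}^{\mathrm{BQ}},\ldots,w_{X,n}^{\mathrm{BQ}}$ are positive.
   Context: A kernel $k\colon [a,b]\times[a,b]\to\mathbb{R}$ is positive-definite if it is symmetric and for any distinct points $X=\{x_1,\ldots,x_n\}$ the kernel matrix $K_X$, $[K_X]_{ij}=k(x_j,x_i)$, is (strictly) positive-definite, hence invertible. Write $I_\nu(f)=\int_a^b f\,\mathrm{d}\nu$ and $k_\nu(x)=\int_a^b k(y,x)\,\mathrm{d}\nu(y)$. The Bayesian quadrature weights for $X$ are $w_X^{\mathrm{BQ}}=(w_{X,i}^{\mathrm{BQ}})_{i=1}^n = K_X^{-1}k_{\nu,X}\in\mathbb{R}^n$, where $[k_{\nu,X}]_i=k_\nu(x_i)$. The integral variance is $\mathbb{V}_X^{\mathrm{BQ}}=I_\nu(k_\nu)-k_{\nu,X}^{\mathsf T}K_X^{-1}k_{\nu,X}$. $\mathcal{S}^n=\{z\in[a,b]^n : a<z_1<\cdots<z_n<b\}$; an element $X=(x_1,\ldots,x_n)\in\mathcal{S}^n$ is identified with the point set $\{x_1,\ldots,x_n\}$. The point set $X\in\mathcal{S}^n$ is locally optimal if $\frac{\partial}{\partial z_j}\mathbb{V}_Z^{\mathrm{BQ}}\big|_{Z=X}=0$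 for every $j\in\{1,\ldots,n\}$, where $Z=(z_1,\ldots,z_n)$ ranges over $\mathcal{S}^n$. $k\in C^\infty([a,b]^2)$ means that the derivatives $\frac{\partial^{2j}}{\partial x^j\partial y^j}k(x,y)$ exist and are continuous for every $j\in\mathbb{N}_0$. Write $k_y^{(j)}(x)=\frac{\partial^j}{\partial z^j}k(x,z)\big|_{z=y}$. A collection $\{\phi_i\}_{i=1}^m\subset C^{m-1}([a,b])$ is an (extended) Chebyshev system if any non-trivial linear combination of $\phi_1,\dots,\phi_m$ has at most $m-1$ zeroes, counting multiplicities. (A zero $x$ of $\phi$ has multiplicity $q$ if $\phi^{(j)}(x)=0$ for $j=0,\ldots,q-1$.) A kernel $k\in C^\infty([a,b]^2)$ is (extended) totally positive of order $q\in\mathbb{N}$ if the collection $\{k_{x_i}^{(j_i)} : i=1,\ldots,m,\ j_i=0,\ldots,q_i-1\}$ is a Chebyshev system for any $m\in\mathbb{N}$, any distinct $x_1,\ldots,x_m\in[a,b]$ and any multiplicities $q_1,\ldots,q_m\le q$. *)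

theory Defs
  imports
    "HOL-Probability.Probability_Measure"
    "Jordan_Normal_Form.Gauss_Jordan_Elimination"
begin

no_notation vec_nth (infixl "$" 90)
no_notation inner (infix "\<bullet>" 70)

section \<open>Derivatives relative to a set\<close>

text \<open>Derivatives are taken within \<open>S\<close>, so on \<open>S = {a..b}\<close> they are one-sided at the end points.
  As with \<^const>\<open>vector_derivative\<close>, the value is meaningful only where the derivative exists.\<close>

primrec nderiv_on :: "real set \<Rightarrow> nat \<Rightarrow> (real \<Rightarrow> real) \<Rightarrow> real \<Rightarrow> real" where
  "nderiv_on S 0 f = f"
| "nderiv_on S (Suc j) f = (\<lambda>x. vector_derivative (nderiv_on S j f) (at x within S))"

definition n_differentiable_on :: "real set \<Rightarrow> nat \<Rightarrow> (real \<Rightarrow> real) \<Rightarrow> bool" where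
  "n_differentiable_on S n f \<longleftrightarrow> (\<forall>j<n. nderiv_on S j f differentiable_on S)"

definition C_on :: "real set \<Rightarrow> nat \<Rightarrow> (real \<Rightarrow> real) \<Rightarrow> bool" where
  "C_on S n f \<longleftrightarrow> n_differentiable_on S n f \<and> continuous_on S (nderiv_on S n f)"

definition kernel_deriv :: "real set \<Rightarrow> (real \<Rightarrow> real \<Rightarrow> real) \<Rightarrow> nat \<Rightarrow> real \<Rightarrow> real \<Rightarrow> real" where
  "kernel_deriv S k j y = (\<lambda>x. nderiv_on S j (\<lambda>z. k x z) y)"

text \<open>Only the mixed derivatives \<open>\<partial>\<^sup>2\<^sup>j / \<partial>x\<^sup>j \<partial>y\<^sup>j\<close> are required to exist
  (as iterated derivatives, first in \<open>y\<close> and then in \<open>x\<close>) and to be jointly continuous.\<close>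

definition smooth_kernel :: "real set \<Rightarrow> (real \<Rightarrow> real \<Rightarrow> real) \<Rightarrow> bool" where
  "smooth_kernel S k \<longleftrightarrow>
     (\<forall>j. (\<forall>x\<in>S. n_differentiable_on S j (\<lambda>y. k x y)) \<and>
          (\<forall>y\<in>S. n_differentiable_on S j (kernel_deriv S k j y)) \<and>
          continuous_on (S \<times> S) (\<lambda>(x, y). nderiv_on S j (kernel_deriv S k j y) x))"

section \<open>Positive-definite kernels\<close>

definition kernel_matrix :: "(real \<Rightarrow> real \<Rightarrow> real) \<Rightarrow> real vec \<Rightarrow> real mat" where
  "kernel_matrix k X = mat (dim_vec X) (dim_vec X) (\<lambda>(i, j). k (X $ j) (X $ i))"

definition positive_definite_mat :: "real mat \<Rightarrow> bool" where
  "positive_definite_mat A \<longleftrightarrow> square_mat A \<and> A\<^sup>T = A \<and>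
     (\<forall>v \<in> carrier_vec (dim_row A). v \<noteq> 0\<^sub>v (dim_row A) \<longrightarrow> 0 < v \<bullet> (A *\<^sub>v v))"

definition positive_definite_kernel :: "real set \<Rightarrow> (real \<Rightarrow> real \<Rightarrow> real) \<Rightarrow> bool" where
  "positive_definite_kernel S k \<longleftrightarrow>
     (\<forall>x\<in>S. \<forall>y\<in>S. k x y = k y x) \<and>
     (\<forall>n. \<forall>X \<in> carrier_vec n. (\<forall>i<n. X $ i \<in> S) \<and> inj_on (\<lambda>i. X $ i) {..<n}
        \<longrightarrow> positive_definite_mat (kernel_matrix k X))"

section \<open>Chebyshev systems and total positivity\<close>

definition zero_of_multiplicity :: "real set \<Rightarrow> (real \<Rightarrow> real) \<Rightarrow> real \<Rightarrow> nat \<Rightarrow> bool" where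
  "zero_of_multiplicity S f x q \<longleftrightarrow> (\<forall>j<q. nderiv_on S j f x = 0)"

text \<open>A function has at least \<open>N\<close> zeroes counting multiplicities iff there are finitely many points
  with multiplicities \<open>\<mu>\<close> adding up to \<open>N\<close>.  For a system of \<open>m\<close> functions of class \<open>C\<^sup>m\<^sup>-\<^sup>1\<close> only
  derivatives up to order \<open>m - 1\<close> are available, whence \<open>\<mu> x \<le> m\<close>.  A system is an indexed family,
  so repeated functions count repeatedly.\<close>

definition chebyshev_system :: "real set \<Rightarrow> 'i set \<Rightarrow> ('i \<Rightarrow> real \<Rightarrow> real) \<Rightarrow> bool" where
  "chebyshev_system S I \<phi> \<longleftrightarrow>
     (\<forall>i\<in>I. C_on S (card I - 1) (\<phi> i)) \<and>
     (\<forall>c :: 'i \<Rightarrow> real. (\<exists>i\<in>I. c i \<noteq> 0) \<longrightarrow>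
        (\<forall>Z \<mu>. finite Z \<and> Z \<subseteq> S \<and>
            (\<forall>x\<in>Z. \<mu> x \<le> card I \<and> zero_of_multiplicity S (\<lambda>x. \<Sum>i\<in>I. c i * \<phi> i x) x (\<mu> x))
          \<longrightarrow> (\<Sum>x\<in>Z. \<mu> x) \<le> card I - 1))"

definition totally_positive :: "real set \<Rightarrow> nat \<Rightarrow> (real \<Rightarrow> real \<Rightarrow> real) \<Rightarrow> bool" where
  "totally_positive S q k \<longleftrightarrow>
     (\<forall>m (x :: nat \<Rightarrow> real) (p :: nat \<Rightarrow> nat).
        (\<forall>i<m. x i \<in> S) \<and> inj_on x {..<m} \<and> (\<forall>i<m. 1 \<le> p i \<and> p i \<le> q)
        \<longrightarrow> chebyshev_system S (SIGMA i:{..<m}. {..<p i}) (\<lambda>(i, j). kernel_deriv S k j (x i)))"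

section \<open>Bayesian quadrature\<close>

definition kernel_mean :: "real measure \<Rightarrow> (real \<Rightarrow> real \<Rightarrow> real) \<Rightarrow> real \<Rightarrow> real" where
  "kernel_mean \<nu> k x = (LINT y|\<nu>. k y x)"

definition kernel_mean_vec :: "real measure \<Rightarrow> (real \<Rightarrow> real \<Rightarrow> real) \<Rightarrow> real vec \<Rightarrow> real vec" where
  "kernel_mean_vec \<nu> k X = vec (dim_vec X) (\<lambda>i. kernel_mean \<nu> k (X $ i))"

text \<open>\<^const>\<open>mat_inverse\<close> returns \<^const>\<open>None\<close> on singular matrices; kernel matrices of distinct points
  are invertible for positive-definite kernels.\<close>

definition bq_weights :: "real measure \<Rightarrow> (real \<Rightarrow> real \<Rightarrow> real) \<Rightarrow> real vec \<Rightarrow> real vec" where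
  "bq_weights \<nu> k X = the (mat_inverse (kernel_matrix k X)) *\<^sub>v kernel_mean_vec \<nu> k X"

definition bq_variance :: "real measure \<Rightarrow> (real \<Rightarrow> real \<Rightarrow> real) \<Rightarrow> real vec \<Rightarrow> real" where
  "bq_variance \<nu> k X = (LINT x|\<nu>. kernel_mean \<nu> k x) -
     kernel_mean_vec \<nu> k X \<bullet> (the (mat_inverse (kernel_matrix k X)) *\<^sub>v kernel_mean_vec \<nu> k X)"

definition ordered_points :: "real \<Rightarrow> real \<Rightarrow> nat \<Rightarrow> real vec set" where
  "ordered_points a b n =
     {z \<in> carrier_vec n. (\<forall>i<n. a < z $ i \<and> z $ i < b) \<and> (\<forall>i<n. \<forall>j<n. i < j \<longrightarrow> z $ i < z $ j)}"

text \<open>Since \<open>ordered_points a b n\<close> is open in \<open>\<real>\<^sup>n\<close>, the partial derivatives at \<open>X\<close> are ordinary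
  two-sided derivatives along the coordinates.\<close>

definition locally_optimal :: "real measure \<Rightarrow> (real \<Rightarrow> real \<Rightarrow> real) \<Rightarrow> real vec \<Rightarrow> bool" where
  "locally_optimal \<nu> k X \<longleftrightarrow>
     (\<forall>j<dim_vec X.
        ((\<lambda>t. bq_variance \<nu> k (vec (dim_vec X) (\<lambda>i. if i = j then t else X $ i)))
           has_real_derivative 0) (at (X $ j)))"

end

theory Submission
  imports Defs "Jordan_Normal_Form.Determinant"
begin

text \<open>Write \<open>w\<close> for the weights at \<open>X\<close> and \<open>E f = \<integral> f d\<nu> - (\<Sum>i. w\<^sub>i f(x\<^sub>i))\<close> for the error of the rule.
  The linear system that defines \<open>w\<close> says that \<open>E\<close> vanishes on every kernel section \<open>k(\<cdot>, x\<^sub>i)\<close>.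
  Local optimality adds that \<open>E\<close> vanishes on the derivative \<open>\<partial>\<^sub>y k(\<cdot>, y)\<close> at \<open>y = x\<^sub>j\<close> whenever
  \<open>w\<^sub>j \<noteq> 0\<close> (\<open>locally_optimal_derivative_exact\<close>).  The reason is an envelope argument: the integral
  variance at a point set is the minimum over all weight vectors of a quadratic form
  (\<open>bq_variance_minimal\<close>), so when \<open>x\<^sub>j\<close> moves and the weights stay at \<open>w\<close>, the form lies above the
  variance and touches it at \<open>X\<close>.  Both therefore have derivative \<open>0\<close> there, and the derivative of the form
  is \<open>-2 w\<^sub>j E(\<partial>\<^sub>y k(\<cdot>, x\<^sub>j))\<close>.  In this way the inverse kernel matrix is never differentiated.

  Now fix \<open>j\<close> and let \<open>Y\<close> consist of those other points whose weight is non-zero.  The functions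
  \<open>k(\<cdot>, y)\<close> and \<open>\<partial>\<^sub>y k(\<cdot>, y)\<close> for \<open>y \<in> Y\<close>, together with \<open>k(\<cdot>, x\<^sub>j)\<close>, form a Chebyshev system of
  \<open>2|Y| + 1\<close> functions, so some non-trivial combination \<open>f\<close> has a double zero at every point of \<open>Y\<close>.
  It has no further zeroes, none of the double zeroes has higher multiplicity, and hence \<open>f\<close> does not
  change sign; it may be taken positive off \<open>Y\<close> (\<open>chebyshev_system_double_zeros\<close>).  Since \<open>E f = 0\<close> and
  each node other than \<open>x\<^sub>j\<close> either lies in \<open>Y\<close> or has weight \<open>0\<close>, we get
  \<open>\<integral> f d\<nu> = w\<^sub>j f(x\<^sub>j)\<close>.  The left-hand side is positive because \<open>\<nu>\<close> does not charge the finite set \<open>Y\<close>,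
  and \<open>f(x\<^sub>j) > 0\<close>, so \<open>w\<^sub>j > 0\<close>.  The same choice of \<open>f\<close> excludes negative and zero weights.\<close>

section \<open>Iterated derivatives of linear combinations\<close>

lemma nderiv_on_has_derivative:
  fixes a b :: real
  assumes "a < b" "n_differentiable_on {a..b} n f" "j < n" "x \<in> {a..b}"
  shows "(nderiv_on {a..b} j f has_real_derivative nderiv_on {a..b} (Suc j) f x) (at x within {a..b})"
proof -
  have "nderiv_on {a..b} j f differentiable (at x within {a..b})"
    using assms by (auto simp: n_differentiable_on_def differentiable_on_def)
  then show ?thesis
    by (simp add: vector_derivative_works has_real_derivative_iff_has_vector_derivative)
qed

lemma nderiv_on_sum:
  fixes a b :: real
  assumes "a < b" "\<And>i. i \<in> I \<Longrightarrow> n_differentiable_on {a..b} n (\<phi> i)"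
    and "j \<le> n" "x \<in> {a..b}"
  shows "nderiv_on {a..b} j (\<lambda>x. \<Sum>i\<in>I. c i * \<phi> i x) x = (\<Sum>i\<in>I. c i * nderiv_on {a..b} j (\<phi> i) x)"
  using assms(3,4)
proof (induction j arbitrary: x)
  case 0
  then show ?case by simp
next
  case (Suc j)
  let ?F = "\<lambda>x. \<Sum>i\<in>I. c i * \<phi> i x"
  have "((\<lambda>x. \<Sum>i\<in>I. c i * nderiv_on {a..b} j (\<phi> i) x) has_real_derivative
      (\<Sum>i\<in>I. c i * nderiv_on {a..b} (Suc j) (\<phi> i) x)) (at x within {a..b})"
    using assms(1,2) Suc.prems
    by (intro DERIV_sum DERIV_cmult nderiv_on_has_derivative) auto
  then have "(nderiv_on {a..b} j ?F has_real_derivative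
      (\<Sum>i\<in>I. c i * nderiv_on {a..b} (Suc j) (\<phi> i) x)) (at x within {a..b})"
    by (rule has_field_derivative_transform_within[where d = 1])
      (use Suc in auto)
  then show ?case
    using vector_derivative_within_closed_interval[OF assms(1) Suc.prems(2)]
    by (simp add: has_real_derivative_iff_has_vector_derivative)
qed

lemma n_differentiable_on_sum:
  fixes a b :: real
  assumes "a < b" "\<And>i. i \<in> I \<Longrightarrow> n_differentiable_on {a..b} n (\<phi> i)"
  shows "n_differentiable_on {a..b} n (\<lambda>x. \<Sum>i\<in>I. c i * \<phi> i x)"
  unfolding n_differentiable_on_def
proof (intro allI impI)
  fix j assume j: "j < n"
  have "(\<lambda>x. \<Sum>i\<in>I. c i * nderiv_on {a..b} j (\<phi> i) x) differentiable_on {a..b}"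
  proof (cases "finite I")
    case True
    then show ?thesis
      using assms(2) j unfolding n_differentiable_on_def differentiable_on_def
      by (intro ballI differentiable_sum differentiable_mult) auto
  qed auto
  then have "(\<lambda>x. \<Sum>i\<in>I. c i * nderiv_on {a..b} j (\<phi> i) x) differentiable at x within {a..b}"
    if "x \<in> {a..b}" for x
    using that by (simp add: differentiable_on_def)
  then have "nderiv_on {a..b} j (\<lambda>x. \<Sum>i\<in>I. c i * \<phi> i x) differentiable at x within {a..b}"
    if "x \<in> {a..b}" for x
    by (rule differentiable_transform_within[where d = 1])
      (use j that in \<open>auto simp: nderiv_on_sum[OF assms]\<close>)
  then show "nderiv_on {a..b} j (\<lambda>x. \<Sum>i\<in>I. c i * \<phi> i x) differentiable_on {a..b}"
    by (simp add: differentiable_on_def)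
qed

section \<open>Functions whose zeroes are double\<close>

text \<open>Near \<open>y\<close> the difference quotient of \<open>f'\<close> has the sign of \<open>d\<close>, so \<open>f'\<close> has the sign of \<open>(x - y) d\<close>;
  the mean value theorem turns this into the sign \<open>d\<close> for \<open>f\<close> on both sides of \<open>y\<close>.\<close>

lemma double_zero_local_sign:
  fixes f f' :: "real \<Rightarrow> real"
  assumes f: "\<And>x. x \<in> {a..b} \<Longrightarrow> (f has_real_derivative f' x) (at x within {a..b})"
    and f': "(f' has_real_derivative d) (at y within {a..b})"
    and y: "y \<in> {a..b}" "f y = 0" "f' y = 0" and d: "d \<noteq> 0"
  obtains e where "e > 0" "\<And>x. x \<in> {a..b} \<Longrightarrow> x \<noteq> y \<Longrightarrow> dist x y < e \<Longrightarrow> 0 < f x * d"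
proof -
  have "((\<lambda>x. (f' x - f' y) / (x - y) * d) \<longlongrightarrow> d * d) (at y within {a..b})"
    using f' by (intro tendsto_intros) (simp add: has_field_derivative_iff)
  then have "eventually (\<lambda>x. 0 < (f' x - f' y) / (x - y) * d) (at y within {a..b})"
    by (rule order_tendstoD(1)) (use d in \<open>auto simp: zero_less_mult_iff\<close>)
  then obtain e where e: "e > 0" and
    pos: "\<And>x. x \<in> {a..b} \<Longrightarrow> x \<noteq> y \<Longrightarrow> dist x y < e \<Longrightarrow> 0 < f' x / (x - y) * d"
    using y by (auto simp: eventually_at)
  have "0 < f x * d" if x: "x \<in> {a..b}" "x \<noteq> y" "dist x y < e" for x
  proof -
    obtain z where z: "z \<in> {min x y<..<max x y}"
      "f (max x y) - f (min x y) = f' z * (max x y - min x y)"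
      using mvt_simple[of "min x y" "max x y" f "\<lambda>z. (*) (f' z)"] x y
        has_field_derivative_subset[OF f]
      by (force simp: has_field_derivative_def min_def max_def split: if_splits)
    have "0 < f' z / (z - y) * d"
      using z x y by (intro pos) (auto simp: dist_real_def)
    moreover have "f x = f' z * (x - y)" "z \<noteq> y"
      using z x y by (auto simp: min_def max_def algebra_simps split: if_splits)
    then have "f x = f' z / (z - y) * ((z - y) * (x - y))" by simp
    moreover have "0 < (z - y) * (x - y)"
      using z x by (auto simp: min_def max_def zero_less_mult_iff split: if_splits)
    ultimately show ?thesis
      by (metis mult.assoc mult.commute mult_pos_pos)
  qed
  with e show thesis by (rule that)
qed

text \<open>The sign is locally constant off \<open>Y\<close>, also across the points of \<open>Y\<close>, and an interval is connected.\<close>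

lemma constant_sign_off_finite_set:
  fixes f :: "real \<Rightarrow> real"
  assumes ab: "a < b" and cont: "continuous_on {a..b} f" and Y: "finite Y"
    and nz: "\<And>x. x \<in> {a..b} - Y \<Longrightarrow> f x \<noteq> 0"
    and sgn: "\<And>y. y \<in> Y \<Longrightarrow> \<exists>e>0. \<exists>d. \<forall>x\<in>{a..b} - Y. dist x y < e \<longrightarrow> 0 < f x * d"
  shows "(\<forall>x\<in>{a..b} - Y. 0 < f x) \<or> (\<forall>x\<in>{a..b} - Y. f x < 0)"
proof -
  have local: "\<exists>e>0. \<forall>x\<in>{a..b} - Y. \<forall>y\<in>{a..b} - Y. dist x z < e \<and> dist y z < e \<longrightarrow> 0 < f x * f y"
    if z: "z \<in> {a..b}" for z
  proof -
    have "\<exists>e>0. \<exists>d. \<forall>x\<in>{a..b} - Y. dist x z < e \<longrightarrow> 0 < f x * d"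
    proof (cases "z \<in> Y")
      case False
      have "((\<lambda>x. f x * f z) \<longlongrightarrow> f z * f z) (at z within {a..b})"
        using z cont by (intro tendsto_intros) (auto simp: continuous_on)
      then have "eventually (\<lambda>x. 0 < f x * f z) (at z within {a..b})"
        by (rule order_tendstoD(1)) (use nz[of z] z False in \<open>auto simp: zero_less_mult_iff\<close>)
      then show ?thesis
        using nz[of z] z False unfolding eventually_at
        by (metis DiffD1 DiffI not_real_square_gt_zero)
    qed (use sgn in blast)
    then obtain e d where e: "e > 0" "\<And>x. x \<in> {a..b} - Y \<Longrightarrow> dist x z < e \<Longrightarrow> 0 < f x * d"
      by blast
    have "0 < f x * f y"
      if "x \<in> {a..b} - Y" "y \<in> {a..b} - Y" "dist x z < e" "dist y z < e" for x y
      using e(2)[of x] e(2)[of y] that by (simp add: zero_less_mult_iff) linarith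
    with e(1) show ?thesis by blast
  qed
  have pos: "0 < f v" if uv: "u \<in> {a..b} - Y" "v \<in> {a..b} - Y" "0 < f u" for u v
  proof (rule connected_induction[where S = "{a..b}" and P = "\<lambda>x. x \<notin> Y" and Q = "\<lambda>x. 0 < f x" and a = u])
    \<comment> \<open>The complement of the finite set \<open>Y\<close> is dense: a non-empty relatively
      open subset of the interval is infinite.\<close>
    fix T c assume T: "openin (top_of_set {a..b}) T" "c \<in> T"
    then have c: "c \<in> {a..b}" using openin_imp_subset by blast
    then have "c islimpt {a..b}" using ab by (simp add: islimpt_Icc)
    moreover from T obtain U where "open U" "T = {a..b} \<inter> U"
      by (auto simp: openin_open)
    ultimately have "infinite T"
      using T c islimpt_eq_acc_point by (metis Int_commute IntD2)
    then show "\<exists>z. z \<in> T \<and> z \<notin> Y"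
      using Y by (meson infinite_super subsetI)
  next
    fix z assume "z \<in> {a..b}"
    from local[OF this] obtain e where e: "e > 0"
      "\<And>x y. x \<in> {a..b} - Y \<Longrightarrow> y \<in> {a..b} - Y \<Longrightarrow> dist x z < e \<Longrightarrow> dist y z < e \<Longrightarrow> 0 < f x * f y"
      by blast
    have "0 < f y" if "x \<in> {a..b} \<inter> ball z e" "y \<in> {a..b} \<inter> ball z e" "x \<notin> Y" "y \<notin> Y" "0 < f x" for x y
      using e(2)[of x y] that by (auto simp: dist_commute zero_less_mult_iff)
    then show "\<exists>T. openin (top_of_set {a..b}) T \<and> z \<in> T \<and>
        (\<forall>x\<in>T. \<forall>y\<in>T. x \<notin> Y \<and> y \<notin> Y \<and> 0 < f x \<longrightarrow> 0 < f y)"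
      using \<open>z \<in> {a..b}\<close> e(1)
      by (intro exI[of _ "{a..b} \<inter> ball z e"] conjI openin_open_Int) (simp, simp, blast)
  qed (use uv in auto)
  show ?thesis
    using pos nz by (metis linorder_less_linear)
qed

section \<open>Positive functions in the span of a Chebyshev system\<close>

text \<open>Padding the coefficient matrix with zero rows makes it square and singular.\<close>

lemma underdetermined_homogeneous_system:
  fixes A :: "'q \<Rightarrow> 'i \<Rightarrow> 'a::field"
  assumes "finite I" "finite C" "card C < card I"
  obtains c where "\<exists>i\<in>I. c i \<noteq> 0" "\<And>q. q \<in> C \<Longrightarrow> (\<Sum>i\<in>I. A q i * c i) = 0"
proof -
  let ?n = "card I" and ?r = "card C"
  obtain g where g: "bij_betw g {0..<?n} I" using ex_bij_betw_nat_finite[OF assms(1)] by blast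
  obtain h where h: "bij_betw h {0..<?r} C" using ex_bij_betw_nat_finite[OF assms(2)] by blast
  define M where "M = mat\<^sub>r ?n ?n (\<lambda>i. if i = ?r then 0\<^sub>v ?n else
    vec ?n (\<lambda>j. if i < ?r then A (h i) (g j) else 0))"
  have "det M = 0" unfolding M_def using assms(3) by (intro det_row_0) auto
  moreover have M: "M \<in> carrier_mat ?n ?n" by (simp add: M_def)
  ultimately obtain v where v: "v \<in> carrier_vec ?n" "v \<noteq> 0\<^sub>v ?n" "M *\<^sub>v v = 0\<^sub>v ?n"
    using det_0_iff_vec_prod_zero_field by blast
  define c where "c = (\<lambda>i. v $ (inv_into {0..<?n} g i))"
  have cg: "c (g j) = v $ j" if "j < ?n" for j
    using g that by (simp add: c_def bij_betw_def)
  show thesis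
  proof (rule that)
    from v obtain j where "j < ?n" "v $ j \<noteq> 0"
      by (metis carrier_vecD eq_vecI index_zero_vec)
    then show "\<exists>i\<in>I. c i \<noteq> 0"
      using g cg by (metis atLeastLessThan_iff bij_betwE le0)
  next
    fix q assume "q \<in> C"
    then obtain i where i: "i < ?r" "q = h i"
      using h by (metis atLeastLessThan_iff bij_betw_imp_surj_on imageE)
    have "(\<Sum>i\<in>I. A q i * c i) = (\<Sum>j\<in>{0..<?n}. A q (g j) * c (g j))"
      by (rule sum.reindex_bij_betw[OF g, symmetric])
    also have "\<dots> = (M *\<^sub>v v) $ i"
      using i assms(3) v(1) M cg by (auto simp: scalar_prod_def M_def intro!: sum.cong)
    finally show "(\<Sum>i\<in>I. A q i * c i) = 0"
      using v(3) i assms(3) by simp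
  qed
qed

text \<open>The \<open>2|Y|\<close> conditions for double zeroes on \<open>Y\<close> leave a non-trivial combination of the
  \<open>2|Y| + 1\<close> functions, and these zeroes exhaust the number that a Chebyshev system permits.  Hence
  there is no other zero, and the second derivative does not vanish on \<open>Y\<close>.\<close>

lemma chebyshev_system_double_zeros:
  fixes a b :: real and \<phi> :: "'i \<Rightarrow> real \<Rightarrow> real"
  assumes ab: "a < b" and cheb: "chebyshev_system {a..b} I \<phi>"
    and I: "card I = 2 * card Y + 1" and Y: "finite Y" "Y \<subseteq> {a..b}"
  obtains c where "\<And>y. y \<in> Y \<Longrightarrow> (\<Sum>i\<in>I. c i * \<phi> i y) = 0"
    and "\<And>x. x \<in> {a..b} - Y \<Longrightarrow> 0 < (\<Sum>i\<in>I. c i * \<phi> i x)"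
proof -
  have "finite I" using I by (metis add_is_0 card.infinite one_neq_zero)
  define C where "C = Y \<times> {..<2::nat}"
  have "finite C" "card C < card I" using Y I by (auto simp: C_def)
  then obtain c where c: "\<exists>i\<in>I. c i \<noteq> 0"
    "\<And>q. q \<in> C \<Longrightarrow> (\<Sum>i\<in>I. nderiv_on {a..b} (snd q) (\<phi> i) (fst q) * c i) = 0"
    using underdetermined_homogeneous_system[OF \<open>finite I\<close>, of C "\<lambda>q i. nderiv_on {a..b} (snd q) (\<phi> i) (fst q)"]
    by blast
  define f where "f = (\<lambda>x. \<Sum>i\<in>I. c i * \<phi> i x)"
  have C_on: "C_on {a..b} (card I - 1) (\<phi> i)" if "i \<in> I" for i
    using cheb[unfolded chebyshev_system_def, THEN conjunct1] that by blast
  then have diff: "n_differentiable_on {a..b} (card I - 1) (\<phi> i)" if "i \<in> I" for i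
    using that by (simp add: C_on_def)
  have zeros: "(\<Sum>x\<in>Z. \<mu> x) \<le> card I - 1" if "finite Z" "Z \<subseteq> {a..b}"
    "\<And>x. x \<in> Z \<Longrightarrow> \<mu> x \<le> card I" "\<And>x. x \<in> Z \<Longrightarrow> zero_of_multiplicity {a..b} f x (\<mu> x)" for Z \<mu>
    using cheb[unfolded chebyshev_system_def, THEN conjunct2, THEN spec, THEN mp, OF c(1),
        THEN spec, THEN spec, THEN mp, of Z \<mu>] that
    unfolding f_def by simp
  have f_deriv: "nderiv_on {a..b} j f y = 0" if "y \<in> Y" "j < 2" for y j
  proof -
    have "card Y \<ge> 1" using Y(1) that(1) by (auto simp: Suc_le_eq card_gt_0_iff)
    then have "j \<le> card I - 1" using I that(2) by simp
    then have "nderiv_on {a..b} j f y = (\<Sum>i\<in>I. c i * nderiv_on {a..b} j (\<phi> i) y)"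
      unfolding f_def using Y(2) that(1) by (intro nderiv_on_sum[OF ab diff]) auto
    also have "\<dots> = 0"
      using c(2)[of "(y, j)"] that by (simp add: C_def mult.commute)
    finally show ?thesis .
  qed
  have nz: "f x \<noteq> 0" if x: "x \<in> {a..b} - Y" for x
  proof
    assume "f x = 0"
    \<comment> \<open>A further zero at \<open>x\<close> would make \<open>2|Y| + 1\<close> zeroes in all.\<close>
    have "(\<Sum>t\<in>insert x Y. if t = x then 1 else 2) \<le> card I - 1"
    proof (rule zeros)
      show "(if t = x then 1 else 2) \<le> card I" if "t \<in> insert x Y" for t
        using that I Y(1) by (auto simp: Suc_le_eq card_gt_0_iff)
      show "zero_of_multiplicity {a..b} f t (if t = x then 1 else 2)" if "t \<in> insert x Y" for t
        using that f_deriv \<open>f x = 0\<close> by (auto simp: zero_of_multiplicity_def)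
    qed (use Y x in auto)
    moreover have "(\<Sum>t\<in>Y. if t = x then 1 else 2) = (\<Sum>t\<in>Y. 2::nat)"
      using x by (intro sum.cong) auto
    ultimately show False using x I Y(1) by simp
  qed
  have local_sign: "\<exists>e>0. \<exists>d. \<forall>x\<in>{a..b} - Y. dist x y < e \<longrightarrow> 0 < f x * d" if y: "y \<in> Y" for y
  proof -
    let ?D = "\<lambda>j. nderiv_on {a..b} j f"
    have Y1: "card Y \<ge> 1" using Y(1) y by (auto simp: Suc_le_eq card_gt_0_iff)
    have "n_differentiable_on {a..b} (card I - 1) f"
      unfolding f_def by (rule n_differentiable_on_sum[OF ab diff])
    from nderiv_on_has_derivative[OF ab this]
    have D: "(?D j has_real_derivative ?D (Suc j) x) (at x within {a..b})" if "x \<in> {a..b}" "j < 2" for x j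
      using that I Y1 by auto
    have D2: "?D 2 y \<noteq> 0"
    proof
      assume triple: "?D 2 y = 0"
      \<comment> \<open>A triple zero at \<open>y\<close> would also make \<open>2|Y| + 1\<close> zeroes.\<close>
      have "(\<Sum>t\<in>Y. 2 + (if t = y then 1 else 0)) \<le> card I - 1"
      proof (rule zeros)
        show "zero_of_multiplicity {a..b} f t (2 + (if t = y then 1 else 0))" if "t \<in> Y" for t
          unfolding zero_of_multiplicity_def
        proof (intro allI impI)
          fix j :: nat assume "j < 2 + (if t = y then 1 else 0)"
          then consider "j < 2" | "j = 2" "t = y"
            by (cases "t = y"; cases "j < 2") (auto simp: less_Suc_eq numeral_2_eq_2)
          then show "nderiv_on {a..b} j f t = 0"
            using f_deriv[OF that] triple by cases simp_all
        qed
      qed (use Y I Y1 in auto)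
      then have "(\<Sum>t\<in>Y. 2) + (\<Sum>t\<in>Y. if t = y then 1 else 0) \<le> card I - 1"
        by (simp only: sum.distrib)
      then show False using I Y(1) y by simp
    qed
    obtain e where "e > 0" "\<And>x. x \<in> {a..b} \<Longrightarrow> x \<noteq> y \<Longrightarrow> dist x y < e \<Longrightarrow> 0 < f x * ?D 2 y"
    proof (rule double_zero_local_sign[of a b f "?D 1" "?D 2 y" y])
      show "(f has_real_derivative ?D 1 x) (at x within {a..b})" if "x \<in> {a..b}" for x
        using D[OF that, of 0] by simp
      show "y \<in> {a..b}" using y Y(2) by blast
      then show "(?D 1 has_real_derivative ?D 2 y) (at y within {a..b})"
        using D[of y 1] by (simp only: Suc_1 one_less_numeral_iff semiring_norm)
      show "f y = 0" "?D 1 y = 0" using f_deriv[OF y, of 0] f_deriv[OF y, of 1] by simp_all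
      show "?D 2 y \<noteq> 0" by (rule D2)
    qed (use that in blast)
    with y show ?thesis by (metis DiffE)
  qed
  have "continuous_on {a..b} (\<phi> i)" if "i \<in> I" for i
  \<comment> \<open>If \<open>Y\<close> is empty, the system is a single function that is only known to be continuous.\<close>
  proof (cases "card I - 1 = 0")
    case True
    then show ?thesis using C_on[OF that] by (simp add: C_on_def)
  next
    case False
    then have "nderiv_on {a..b} 0 (\<phi> i) differentiable_on {a..b}"
      using diff[OF that] unfolding n_differentiable_on_def by blast
    then show ?thesis by (simp add: differentiable_imp_continuous_on)
  qed
  then have "continuous_on {a..b} f"
    unfolding f_def by (intro continuous_intros)
  from this have "(\<forall>x\<in>{a..b} - Y. 0 < f x) \<or> (\<forall>x\<in>{a..b} - Y. f x < 0)"
    by (rule constant_sign_off_finite_set[OF ab _ Y(1) nz local_sign])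
  then obtain s where s: "\<And>x. x \<in> {a..b} - Y \<Longrightarrow> 0 < s * f x"
  proof (elim disjE)
    assume "\<forall>x\<in>{a..b} - Y. 0 < f x"
    then show thesis by (intro that[of 1]) simp
  next
    assume "\<forall>x\<in>{a..b} - Y. f x < 0"
    then show thesis by (intro that[of "-1"]) simp
  qed
  have f: "(\<Sum>i\<in>I. s * c i * \<phi> i x) = s * f x" for x
    by (simp add: f_def sum_distrib_left mult.assoc)
  show thesis
  proof (rule that)
    show "(\<Sum>i\<in>I. s * c i * \<phi> i y) = 0" if "y \<in> Y" for y
      using f_deriv[OF that, of 0] unfolding f by simp
    show "0 < (\<Sum>i\<in>I. s * c i * \<phi> i x)" if "x \<in> {a..b} - Y" for x
      using s[OF that] unfolding f .
  qed
qed

lemma chebyshev_system_reindex: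
  assumes g: "bij_betw g I J" and "chebyshev_system S I (\<lambda>i. \<phi> (g i))"
  shows "chebyshev_system S J \<phi>"
proof -
  have card: "card J = card I" using bij_betw_same_card[OF g] by simp
  have sum: "(\<lambda>x. \<Sum>i\<in>J. c i * \<phi> i x) = (\<lambda>x. \<Sum>i\<in>I. c (g i) * \<phi> (g i) x)" for c
    by (intro ext sum.reindex_bij_betw[OF g, symmetric])
  have J: "J = g ` I" using g by (simp add: bij_betw_def)
  have "\<forall>Z \<mu>. finite Z \<and> Z \<subseteq> S \<and>
      (\<forall>x\<in>Z. \<mu> x \<le> card J \<and> zero_of_multiplicity S (\<lambda>x. \<Sum>i\<in>J. c i * \<phi> i x) x (\<mu> x))
    \<longrightarrow> (\<Sum>x\<in>Z. \<mu> x) \<le> card J - 1" if "\<exists>i\<in>J. c i \<noteq> 0" for c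
  proof -
    have "\<exists>i\<in>I. c (g i) \<noteq> 0" using that unfolding J by simp
    from assms(2)[unfolded chebyshev_system_def, THEN conjunct2, THEN spec, THEN mp, OF this]
    show ?thesis unfolding card sum .
  qed
  moreover have "\<forall>i\<in>J. C_on S (card J - 1) (\<phi> i)"
    using assms(2)[unfolded chebyshev_system_def, THEN conjunct1] unfolding card by (simp add: J)
  ultimately show ?thesis
    unfolding chebyshev_system_def by (intro conjI allI impI) simp_all
qed

text \<open>Total positivity of order two, for the points of \<open>Y\<close> with multiplicity two and the point \<open>z\<close> with
  multiplicity one.  The system is indexed by the points themselves instead of by their position in a list.\<close>

lemma totally_positive_chebyshev_system:
  assumes tp: "totally_positive S 2 k" and Y: "finite Y" "Y \<subseteq> S" and z: "z \<in> S - Y"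
  shows "chebyshev_system S (insert (z, 0) (Y \<times> {..<2::nat})) (\<lambda>(y, j). kernel_deriv S k j y)"
proof -
  let ?m = "card Y"
  obtain h where h: "bij_betw h {..<?m} Y"
    using ex_bij_betw_nat_finite[OF Y(1)] by (auto simp: atLeast0LessThan)
  define x where "x = (\<lambda>i. if i < ?m then h i else z)"
  define p :: "nat \<Rightarrow> nat" where "p = (\<lambda>i. if i < ?m then 2 else 1)"
  have hY: "h i \<in> Y" if "i < ?m" for i using h that by (auto simp: bij_betw_def)
  have inj: "inj_on x {..<Suc ?m}"
    using h z hY by (auto simp: x_def inj_on_def bij_betw_def less_Suc_eq)
  have "chebyshev_system S (SIGMA i:{..<Suc ?m}. {..<p i}) (\<lambda>(i, j). kernel_deriv S k j (x i))"
    by (intro tp[unfolded totally_positive_def, rule_format] conjI inj allI impI)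
      (use Y z hY in \<open>auto simp: x_def p_def\<close>)
  moreover have "(SIGMA i:{..<Suc ?m}. {..<p i}) = insert (?m, 0) ({..<?m} \<times> {..<2::nat})"
    by (auto simp: p_def less_Suc_eq split: if_splits)
  moreover have "bij_betw (map_prod x id) (insert (?m, 0) ({..<?m} \<times> {..<2::nat})) (insert (z, 0) (Y \<times> {..<2::nat}))"
  proof (rule bij_betw_imageI)
    show "inj_on (map_prod x id) (insert (?m, 0) ({..<?m} \<times> {..<2::nat}))"
      by (rule inj_on_subset[of _ "{..<Suc ?m} \<times> UNIV"])
        (use inj in \<open>auto intro!: map_prod_inj_on\<close>)
    have "x ` {..<?m} = Y" using h by (auto simp: x_def bij_betw_def)
    then show "map_prod x id ` (insert (?m, 0) ({..<?m} \<times> {..<2::nat})) = insert (z, 0) (Y \<times> {..<2::nat})"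
      by (simp add: map_prod_surj_on) (simp add: x_def)
  qed
  ultimately show ?thesis
    by (intro chebyshev_system_reindex[of "map_prod x id"]) (simp_all add: case_prod_unfold)
qed

section \<open>Differential calculus of smooth kernels\<close>

lemma smooth_kernel_partial_derivative:
  fixes a b :: real
  assumes "a < b" "smooth_kernel {a..b} k" "x \<in> {a..b}" "y \<in> {a..b}"
  shows "((\<lambda>z. k x z) has_real_derivative kernel_deriv {a..b} k 1 y x) (at y within {a..b})"
  using nderiv_on_has_derivative[OF assms(1), of 1 "\<lambda>y. k x y" 0 y] assms
  by (auto simp: smooth_kernel_def kernel_deriv_def)

lemma smooth_kernel_differentiable:
  "smooth_kernel S k \<Longrightarrow> y \<in> S \<Longrightarrow> n_differentiable_on S n (kernel_deriv S k n y)"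
  by (simp add: smooth_kernel_def)

lemma continuous_on_smooth_kernel:
  assumes "smooth_kernel S k"
  shows "continuous_on (S \<times> S) (\<lambda>(x, y). k x y)"
proof -
  from assms have "continuous_on (S \<times> S) (\<lambda>(x, y). nderiv_on S 0 (kernel_deriv S k 0 y) x)"
    unfolding smooth_kernel_def by blast
  then show ?thesis by (simp add: kernel_deriv_def)
qed

lemma continuous_on_kernel_deriv:
  assumes "smooth_kernel S k" "y \<in> S" "j \<le> 1"
  shows "continuous_on S (kernel_deriv S k j y)"
proof (cases "j = 0")
  case True
  have "continuous_on S (\<lambda>x. (\<lambda>(x, y). k x y) (x, y))"
    by (rule continuous_on_compose2[OF continuous_on_smooth_kernel[OF assms(1)]])
      (use assms(2) in \<open>auto intro!: continuous_intros\<close>)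
  then show ?thesis using True by (simp add: kernel_deriv_def)
next
  case False
  with assms(3) have "j = 1" by simp
  with smooth_kernel_differentiable[OF assms(1,2), of 1] show ?thesis
    by (simp add: n_differentiable_on_def differentiable_imp_continuous_on)
qed

text \<open>The mixed derivative \<open>\<partial>\<^sub>x \<partial>\<^sub>y k\<close> is continuous on a compact square, hence bounded.\<close>

lemma kernel_deriv_lipschitz:
  fixes a b :: real
  assumes "a < b" "smooth_kernel {a..b} k"
  obtains M where "M \<ge> 0" "\<And>x x' y. x \<in> {a..b} \<Longrightarrow> x' \<in> {a..b} \<Longrightarrow> y \<in> {a..b} \<Longrightarrow>
    \<bar>kernel_deriv {a..b} k 1 y x - kernel_deriv {a..b} k 1 y x'\<bar> \<le> M * \<bar>x - x'\<bar>"
proof -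
  let ?D = "\<lambda>(x, y). nderiv_on {a..b} 1 (kernel_deriv {a..b} k 1 y) x"
  have "continuous_on ({a..b} \<times> {a..b}) ?D"
    using assms(2) unfolding smooth_kernel_def by blast
  then have "bounded (?D ` ({a..b} \<times> {a..b}))"
    by (intro compact_imp_bounded compact_continuous_image compact_Times compact_Icc)
  then obtain M where M: "M > 0" "\<forall>z \<in> ?D ` ({a..b} \<times> {a..b}). norm z \<le> M"
    unfolding bounded_pos by blast
  show thesis
  proof (rule that)
    fix x x' y assume xy: "x \<in> {a..b}" "x' \<in> {a..b}" "y \<in> {a..b}"
    have "norm (kernel_deriv {a..b} k 1 y x - kernel_deriv {a..b} k 1 y x') \<le> M * norm (x - x')"
    proof (rule field_differentiable_bound[where S = "{a..b}"])
      fix z assume z: "z \<in> {a..b}"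
      show "(kernel_deriv {a..b} k 1 y has_real_derivative ?D (z, y)) (at z within {a..b})"
        using nderiv_on_has_derivative[OF assms(1) smooth_kernel_differentiable[OF assms(2) xy(3)], of 0 1] z
        by simp
      show "norm (?D (z, y)) \<le> M" using M(2) z xy(3) by blast
    qed (use xy in auto)
    then show "\<bar>kernel_deriv {a..b} k 1 y x - kernel_deriv {a..b} k 1 y x'\<bar> \<le> M * \<bar>x - x'\<bar>"
      by simp
  qed (use M in simp)
qed

text \<open>Joint continuity of \<open>\<partial>\<^sub>y k\<close> is not among the assumptions.  It is bounded nevertheless: in \<open>y\<close> it is
  continuous along the edge \<open>x = a\<close>, because \<open>k(a, \<cdot>)\<close> is twice differentiable, and in \<open>x\<close> it is
  Lipschitz uniformly in \<open>y\<close>.  This bound is the dominating function for differentiation under the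
  integral sign.\<close>

lemma kernel_deriv_bounded:
  fixes a b :: real
  assumes "a < b" "smooth_kernel {a..b} k"
  obtains B where "\<And>x y. x \<in> {a..b} \<Longrightarrow> y \<in> {a..b} \<Longrightarrow> \<bar>kernel_deriv {a..b} k 1 y x\<bar> \<le> B"
proof -
  obtain M where M: "M \<ge> 0" "\<And>x x' y. x \<in> {a..b} \<Longrightarrow> x' \<in> {a..b} \<Longrightarrow> y \<in> {a..b} \<Longrightarrow>
    \<bar>kernel_deriv {a..b} k 1 y x - kernel_deriv {a..b} k 1 y x'\<bar> \<le> M * \<bar>x - x'\<bar>"
    using kernel_deriv_lipschitz[OF assms] by blast
  have a: "a \<in> {a..b}" using assms(1) by simp
  have "n_differentiable_on {a..b} 2 (\<lambda>y. k a y)"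
    using assms(2) a unfolding smooth_kernel_def by blast
  then have "nderiv_on {a..b} 1 (\<lambda>y. k a y) differentiable_on {a..b}"
    unfolding n_differentiable_on_def by (meson one_less_numeral_iff semiring_norm(76))
  then have "continuous_on {a..b} (\<lambda>y. kernel_deriv {a..b} k 1 y a)"
    unfolding kernel_deriv_def by (rule differentiable_imp_continuous_on)
  then have "bounded ((\<lambda>y. kernel_deriv {a..b} k 1 y a) ` {a..b})"
    by (intro compact_imp_bounded compact_continuous_image compact_Icc)
  then obtain C where C: "\<And>y. y \<in> {a..b} \<Longrightarrow> \<bar>kernel_deriv {a..b} k 1 y a\<bar> \<le> C"
    unfolding bounded_iff real_norm_def by blast
  show thesis
  proof (rule that)
    fix x y assume xy: "x \<in> {a..b}" "y \<in> {a..b}"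
    have "M * \<bar>x - a\<bar> \<le> M * (b - a)"
      using M(1) xy by (intro mult_left_mono) auto
    with M(2)[OF xy(1) a xy(2)] C[OF xy(2)]
    show "\<bar>kernel_deriv {a..b} k 1 y x\<bar> \<le> C + M * (b - a)" by linarith
  qed
qed

text \<open>The total derivative along the diagonal without joint differentiability of \<open>k\<close>: by symmetry,
  \<open>k(s,s) = 2 k(t,s) - k(t,t) + R(s)\<close>, where the second-order difference \<open>R\<close> is \<open>O((s - t)\<^sup>2)\<close>
  because the mixed derivative is bounded.\<close>

lemma kernel_diagonal_derivative:
  fixes a b :: real
  assumes ab: "a < b" and k: "smooth_kernel {a..b} k"
    and sym: "\<And>x y. x \<in> {a..b} \<Longrightarrow> y \<in> {a..b} \<Longrightarrow> k x y = k y x"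
    and t: "t \<in> {a..b}"
  shows "((\<lambda>s. k s s) has_real_derivative 2 * kernel_deriv {a..b} k 1 t t) (at t within {a..b})"
proof -
  obtain M where M: "M \<ge> 0" "\<And>x x' y. x \<in> {a..b} \<Longrightarrow> x' \<in> {a..b} \<Longrightarrow> y \<in> {a..b} \<Longrightarrow>
    \<bar>kernel_deriv {a..b} k 1 y x - kernel_deriv {a..b} k 1 y x'\<bar> \<le> M * \<bar>x - x'\<bar>"
    using kernel_deriv_lipschitz[OF ab k] by blast
  define R where "R = (\<lambda>s. (k s s - k t s) - (k s t - k t t))"
  have eq: "2 * k t s - k t t + R s = k s s" if "s \<in> {a..b}" for s
    using sym[OF that t] by (simp add: R_def)
  have R: "\<bar>R s\<bar> \<le> M * \<bar>s - t\<bar> * \<bar>s - t\<bar>" if s: "s \<in> {a..b}" for s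
  proof -
    have "norm ((k s s - k t s) - (k s t - k t t)) \<le> (M * \<bar>s - t\<bar>) * norm (s - t)"
    proof (rule field_differentiable_bound[where S = "{a..b}"])
      fix z assume z: "z \<in> {a..b}"
      show "((\<lambda>y. k s y - k t y) has_real_derivative
          kernel_deriv {a..b} k 1 z s - kernel_deriv {a..b} k 1 z t) (at z within {a..b})"
        by (intro DERIV_diff smooth_kernel_partial_derivative[OF ab k] s t z)
      show "norm (kernel_deriv {a..b} k 1 z s - kernel_deriv {a..b} k 1 z t) \<le> M * \<bar>s - t\<bar>"
        using M(2)[OF s t z] by simp
    qed (use s t in auto)
    then show ?thesis by (simp add: R_def)
  qed
  have "((\<lambda>s. (R s - R t) / (s - t)) \<longlongrightarrow> 0) (at t within {a..b})"
  proof (rule Lim_null_comparison)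
    have "norm ((R s - R t) / (s - t)) \<le> M * \<bar>s - t\<bar>" if "s \<in> {a..b}" "s \<noteq> t" for s
      using R[OF that(1)] that(2) by (simp add: R_def abs_divide divide_le_eq)
    then show "\<forall>\<^sub>F s in at t within {a..b}. norm ((R s - R t) / (s - t)) \<le> M * \<bar>s - t\<bar>"
      by (auto simp: eventually_at_filter)
    show "((\<lambda>s. M * \<bar>s - t\<bar>) \<longlongrightarrow> 0) (at t within {a..b})"
      by (rule tendsto_eq_intros refl | simp)+
  qed
  then have "(R has_real_derivative 0) (at t within {a..b})"
    by (simp add: has_field_derivative_iff)
  from DERIV_add[OF DERIV_diff[OF DERIV_cmult[OF smooth_kernel_partial_derivative[OF ab k t t], of 2]
        DERIV_const[of "k t t"]] this]
  have "((\<lambda>s. 2 * k t s - k t t + R s) has_real_derivative 2 * kernel_deriv {a..b} k 1 t t)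
      (at t within {a..b})" by simp
  then show ?thesis
    by (rule has_field_derivative_transform_within[where d = 1]) (use t eq in auto)
qed

section \<open>Integration against the measure\<close>

lemma borel_prob_space_Icc:
  assumes "prob_space \<nu>" "sets \<nu> = sets (restrict_space borel {a..b::real})"
  shows "space \<nu> = {a..b}"
    and "continuous_on {a..b} f \<Longrightarrow> integrable \<nu> (f :: real \<Rightarrow> real)"
proof -
  interpret prob_space \<nu> by fact
  show sp: "space \<nu> = {a..b}"
    using sets_eq_imp_space_eq[OF assms(2)] by (simp add: space_restrict_space)
  assume f: "continuous_on {a..b} f"
  then have "bounded (f ` {a..b})"
    by (intro compact_imp_bounded compact_continuous_image compact_Icc)
  then obtain B where "\<forall>x\<in>{a..b}. norm (f x) \<le> B"
    unfolding bounded_iff by auto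
  moreover have "f \<in> borel_measurable \<nu>"
    using borel_measurable_continuous_on_restrict[OF f] measurable_cong_sets[OF assms(2) refl]
    by blast
  ultimately show "integrable \<nu> f"
    by (intro integrable_const_bound[where B = B]) (auto simp: sp)
qed

text \<open>Differentiation under the integral sign, by dominated convergence of the difference quotients.\<close>

lemma kernel_mean_derivative:
  assumes ab: "a < b" and k: "smooth_kernel {a..b} k"
    and \<nu>: "prob_space \<nu>" "sets \<nu> = sets (restrict_space borel {a..b::real})"
    and y: "y \<in> {a..b}"
  shows "(kernel_mean \<nu> k has_real_derivative (LINT x|\<nu>. kernel_deriv {a..b} k 1 y x))
    (at y within {a..b})"
  unfolding has_field_derivative_iff tendsto_at_iff_sequentially
proof (intro allI impI)
  interpret prob_space \<nu> by fact
  note sp = borel_prob_space_Icc(1)[OF \<nu>] and int = borel_prob_space_Icc(2)[OF \<nu>]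
  fix u :: "nat \<Rightarrow> real" assume u: "\<forall>i. u i \<in> {a..b} - {y}" "u \<longlonglongrightarrow> y"
  obtain B where B: "\<And>x y. x \<in> {a..b} \<Longrightarrow> y \<in> {a..b} \<Longrightarrow> \<bar>kernel_deriv {a..b} k 1 y x\<bar> \<le> B"
    using kernel_deriv_bounded[OF ab k] by blast
  have int_k: "integrable \<nu> (\<lambda>x. k x z)" if "z \<in> {a..b}" for z
    using continuous_on_kernel_deriv[OF k that, of 0] by (intro int) (simp add: kernel_deriv_def)
  have int_k': "integrable \<nu> (kernel_deriv {a..b} k 1 y)"
    using continuous_on_kernel_deriv[OF k y, of 1] by (intro int) simp
  let ?q = "\<lambda>i x. (k x (u i) - k x y) / (u i - y)"
  have "(\<lambda>i. LINT x|\<nu>. ?q i x) \<longlonglongrightarrow> (LINT x|\<nu>. kernel_deriv {a..b} k 1 y x)"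
  proof (rule integral_dominated_convergence[where w = "\<lambda>_. B"])
    show "AE x in \<nu>. (\<lambda>i. ?q i x) \<longlonglongrightarrow> kernel_deriv {a..b} k 1 y x"
    proof (rule AE_I2)
      fix x assume "x \<in> space \<nu>"
      then have "((\<lambda>z. (k x z - k x y) / (z - y)) \<longlongrightarrow> kernel_deriv {a..b} k 1 y x) (at y within {a..b})"
        using smooth_kernel_partial_derivative[OF ab k _ y] sp by (simp add: has_field_derivative_iff)
      then show "(\<lambda>i. ?q i x) \<longlonglongrightarrow> kernel_deriv {a..b} k 1 y x"
        using u by (auto simp: tendsto_at_iff_sequentially comp_def)
    qed
    show "AE x in \<nu>. norm (?q i x) \<le> B" for i
    proof (rule AE_I2)
      fix x assume x: "x \<in> space \<nu>"
      have "norm (k x (u i) - k x y) \<le> B * norm (u i - y)"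
        by (rule field_differentiable_bound[where S = "{a..b}" and f' = "\<lambda>y. kernel_deriv {a..b} k 1 y x"])
          (use x u y B sp smooth_kernel_partial_derivative[OF ab k] in auto)
      then show "norm (?q i x) \<le> B"
        using u by (simp add: divide_le_eq)
    qed
    show "integrable \<nu> (\<lambda>_. B)" by simp
    show "?q i \<in> borel_measurable \<nu>" for i
      using int_k[of "u i"] int_k[OF y] u(1) by (intro borel_measurable_divide borel_measurable_diff) auto
  qed (use int_k' in auto)
  moreover have "(LINT x|\<nu>. ?q i x) = (kernel_mean \<nu> k (u i) - kernel_mean \<nu> k y) / (u i - y)" for i
    using Bochner_Integration.integral_diff[OF int_k[of "u i"] int_k[OF y]] u(1)
    by (simp add: kernel_mean_def)
  ultimately have "(\<lambda>i. (kernel_mean \<nu> k (u i) - kernel_mean \<nu> k y) / (u i - y)) \<longlonglongrightarrow>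
      (LINT x|\<nu>. kernel_deriv {a..b} k 1 y x)"
    by (simp only:)
  then show "((\<lambda>z. (kernel_mean \<nu> k z - kernel_mean \<nu> k y) / (z - y)) \<circ> u) \<longlonglongrightarrow>
      (LINT x|\<nu>. kernel_deriv {a..b} k 1 y x)"
    unfolding comp_def .
qed

lemma density_AE_notin_finite:
  assumes "p \<in> borel_measurable (restrict_space lborel {a..b::real})"
    and "\<nu> = density (restrict_space lborel {a..b}) p" "finite Y"
  shows "AE x in \<nu>. x \<notin> Y"
proof -
  have "AE x in lborel. x \<notin> Y"
    using assms(3) by (intro AE_not_in countable_imp_null_set_lborel countable_finite)
  then have "AE x in restrict_space lborel {a..b}. x \<notin> Y"
    by (subst AE_restrict_space_iff) auto
  then show ?thesis
    using assms(1,2) by (auto simp: AE_density elim: eventually_mono)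
qed

section \<open>The integral variance as a minimum over weights\<close>

lemma positive_definite_mat_inverse:
  assumes A: "A \<in> carrier_mat n n" and pd: "positive_definite_mat A"
  shows "A * the (mat_inverse A) = 1\<^sub>m n" "the (mat_inverse A) \<in> carrier_mat n n"
proof -
  have "det A \<noteq> 0"
  proof
    assume "det A = 0"
    then obtain v where v: "v \<in> carrier_vec n" "v \<noteq> 0\<^sub>v n" "A *\<^sub>v v = 0\<^sub>v n"
      using det_0_iff_vec_prod_zero_field[OF A] by blast
    then have "0 < v \<bullet> (A *\<^sub>v v)" using pd A by (auto simp: positive_definite_mat_def)
    then show False using v by simp
  qed
  then have "A \<in> Units (ring_mat TYPE(real) n ())" by (rule det_non_zero_imp_unit[OF A])
  then obtain B where "mat_inverse A = Some B"
    using mat_inverse(1)[OF A, of "()"] by fastforce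
  then show "A * the (mat_inverse A) = 1\<^sub>m n" "the (mat_inverse A) \<in> carrier_mat n n"
    using mat_inverse(2)[OF A] by auto
qed

lemma kernel_matrix_carrier [simp]: "kernel_matrix k X \<in> carrier_mat (dim_vec X) (dim_vec X)"
  and kernel_mean_vec_carrier [simp]: "kernel_mean_vec \<nu> k X \<in> carrier_vec (dim_vec X)"
  by (simp_all add: kernel_matrix_def kernel_mean_vec_def)

lemma bq_weights_system:
  assumes pd: "positive_definite_mat (kernel_matrix k X)"
  shows "bq_weights \<nu> k X \<in> carrier_vec (dim_vec X)"
    and "kernel_matrix k X *\<^sub>v bq_weights \<nu> k X = kernel_mean_vec \<nu> k X"
proof -
  note inv = positive_definite_mat_inverse[OF kernel_matrix_carrier pd]
  show "bq_weights \<nu> k X \<in> carrier_vec (dim_vec X)"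
    unfolding bq_weights_def using inv(2) by (meson kernel_mean_vec_carrier mult_mat_vec_carrier)
  show "kernel_matrix k X *\<^sub>v bq_weights \<nu> k X = kernel_mean_vec \<nu> k X"
    unfolding bq_weights_def
    by (simp add: assoc_mult_mat_vec[OF kernel_matrix_carrier inv(2) kernel_mean_vec_carrier, symmetric] inv(1))
qed

text \<open>In the reproducing kernel Hilbert space of \<open>k\<close>, this is the squared worst-case error of the
  quadrature rule with nodes \<open>X\<close> and arbitrary weights \<open>v\<close>.\<close>

definition quadrature_variance ::
  "real measure \<Rightarrow> (real \<Rightarrow> real \<Rightarrow> real) \<Rightarrow> real vec \<Rightarrow> real vec \<Rightarrow> real" where
  "quadrature_variance \<nu> k X v =
     (LINT x|\<nu>. kernel_mean \<nu> k x) - 2 * (kernel_mean_vec \<nu> k X \<bullet> v) + v \<bullet> (kernel_matrix k X *\<^sub>v v)"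

text \<open>Completing the square: with \<open>K\<close> the kernel matrix and \<open>w\<close> the Bayesian quadrature weights, the
  difference of the two sides of the inequality is \<open>(v - w)\<^sup>T K (v - w)\<close>.\<close>

lemma bq_variance_minimal:
  assumes pd: "positive_definite_mat (kernel_matrix k X)" and v: "v \<in> carrier_vec (dim_vec X)"
  shows "bq_variance \<nu> k X \<le> quadrature_variance \<nu> k X v"
    and "bq_variance \<nu> k X = quadrature_variance \<nu> k X (bq_weights \<nu> k X)"
proof -
  let ?n = "dim_vec X" and ?K = "kernel_matrix k X" and ?m = "kernel_mean_vec \<nu> k X"
  let ?w = "bq_weights \<nu> k X"
  note K = kernel_matrix_carrier[of k X] and m = kernel_mean_vec_carrier[of \<nu> k X]
  note w = bq_weights_system[OF pd, of \<nu>]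
  have var: "bq_variance \<nu> k X = (LINT x|\<nu>. kernel_mean \<nu> k x) - ?m \<bullet> ?w"
    by (simp add: bq_variance_def bq_weights_def)
  then show "bq_variance \<nu> k X = quadrature_variance \<nu> k X ?w"
    unfolding quadrature_variance_def w(2) using comm_scalar_prod[OF m w(1)] by simp
  have Kv: "?K *\<^sub>v v \<in> carrier_vec ?n" using K v by (rule mult_mat_vec_carrier)
  have "?K\<^sup>T = ?K" using pd by (simp add: positive_definite_mat_def)
  then have "?w \<bullet> (?K *\<^sub>v v) = ?m \<bullet> v"
    using transpose_vec_mult_scalar[OF K v w(1)] w(2) by simp
  then have "(v - ?w) \<bullet> (?K *\<^sub>v (v - ?w)) = v \<bullet> (?K *\<^sub>v v) - 2 * (?m \<bullet> v) + ?m \<bullet> ?w"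
    using comm_scalar_prod[OF m w(1)] comm_scalar_prod[OF m v]
    by (simp add: mult_minus_distrib_mat_vec[OF K v w(1)] w(2)
        minus_scalar_prod_distrib[OF v w(1) minus_carrier_vec[OF Kv m]]
        scalar_prod_minus_distrib[OF _ Kv m] v w(1))
  moreover have "0 \<le> (v - ?w) \<bullet> (?K *\<^sub>v (v - ?w))"
  proof (cases "v - ?w = 0\<^sub>v ?n")
    case False
    then show ?thesis
      using pd v w(1) K by (auto simp: positive_definite_mat_def intro!: less_imp_le)
  next
    case True
    then show ?thesis
      by (simp add: scalar_prod_left_zero[OF mult_mat_vec_carrier[OF K zero_carrier_vec]])
  qed
  ultimately show "bq_variance \<nu> k X \<le> quadrature_variance \<nu> k X v"
    unfolding var quadrature_variance_def by simp
qed

lemma quadrature_variance_sum: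
  assumes "v \<in> carrier_vec (dim_vec X)"
  shows "quadrature_variance \<nu> k X v = (LINT x|\<nu>. kernel_mean \<nu> k x)
    - 2 * (\<Sum>i<dim_vec X. v $ i * kernel_mean \<nu> k (X $ i))
    + (\<Sum>i<dim_vec X. \<Sum>l<dim_vec X. v $ i * v $ l * k (X $ l) (X $ i))"
  using assms
  by (auto simp: quadrature_variance_def kernel_mean_vec_def kernel_matrix_def scalar_prod_def
      atLeast0LessThan sum_distrib_left ac_simps intro!: sum.cong)

lemma ordered_points_inj:
  assumes "X \<in> ordered_points a b n"
  shows "inj_on (\<lambda>i. X $ i) {..<n}"
  using assms unfolding inj_on_def ordered_points_def
  by (auto, metis linorder_neqE_nat order_less_irrefl)

lemma ordered_points_positive_definite:
  assumes "positive_definite_kernel {a..b} k" "X \<in> ordered_points a b n"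
  shows "positive_definite_mat (kernel_matrix k X)"
  using assms ordered_points_inj[OF assms(2)]
  by (auto simp: positive_definite_kernel_def ordered_points_def less_imp_le)

text \<open>Moving one node slightly keeps the nodes ordered, so the minimality of the variance is available in a
  whole neighbourhood of that node.\<close>

lemma eventually_ordered_points:
  assumes X: "X \<in> ordered_points a b n" and j: "j < n"
  shows "\<forall>\<^sub>F t in nhds (X $ j). vec n (\<lambda>i. if i = j then t else X $ i) \<in> ordered_points a b n"
proof -
  let ?Z = "\<lambda>t i. if i = j then t else X $ i"
  have lim: "((\<lambda>t. ?Z t i) \<longlongrightarrow> X $ i) (nhds (X $ j))" for i
    by (cases "i = j") (auto intro: filterlim_ident)
  have "\<forall>\<^sub>F t in nhds (X $ j). \<forall>i\<in>{..<n}. a < ?Z t i \<and> ?Z t i < b"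
    using X by (intro eventually_ball_finite ballI eventually_conj order_tendstoD[OF lim])
      (auto simp: ordered_points_def)
  moreover have "\<forall>\<^sub>F t in nhds (X $ j). \<forall>i\<in>{..<n}. \<forall>l\<in>{..<n}. i < l \<longrightarrow> 0 < ?Z t l - ?Z t i"
  proof (intro eventually_ball_finite ballI finite_lessThan)
    fix i l assume "i \<in> {..<n}" "l \<in> {..<n}"
    then show "\<forall>\<^sub>F t in nhds (X $ j). i < l \<longrightarrow> 0 < ?Z t l - ?Z t i"
      using X order_tendstoD(1)[OF tendsto_diff[OF lim[of l] lim[of i]], of 0]
      by (cases "i < l") (auto simp: ordered_points_def)
  qed
  ultimately show ?thesis
    by eventually_elim (simp add: ordered_points_def)
qed

text \<open>With the weights held at \<open>w\<close>, the squared worst-case error minus the variance is non-negative while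
  \<open>x\<^sub>j\<close> stays near the optimal position and zero at that position.  Its derivative there is \<open>w\<^sub>j\<close> times twice the
  difference of the two sides of the conclusion, so a non-zero weight is what allows \<open>w\<^sub>j\<close> to be cancelled.\<close>

lemma locally_optimal_derivative_exact:
  assumes ab: "a < b" and \<nu>: "prob_space \<nu>" "sets \<nu> = sets (restrict_space borel {a..b})"
    and k: "smooth_kernel {a..b} k" and pd: "positive_definite_kernel {a..b} k"
    and X: "X \<in> ordered_points a b n" and opt: "locally_optimal \<nu> k X"
    and j: "j < n" "bq_weights \<nu> k X $ j \<noteq> 0"
  shows "(LINT x|\<nu>. kernel_deriv {a..b} k 1 (X $ j) x) =
    (\<Sum>i<n. bq_weights \<nu> k X $ i * kernel_deriv {a..b} k 1 (X $ j) (X $ i))"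
proof -
  define w where "w = bq_weights \<nu> k X"
  define Z where "Z = (\<lambda>t. vec n (\<lambda>i. if i = j then t else X $ i))"
  let ?S = "{a..b}" and ?y = "X $ j"
  let ?m = "LINT x|\<nu>. kernel_deriv ?S k 1 ?y x" and ?d = "\<lambda>x. kernel_deriv ?S k 1 ?y x"
  have sym: "k x y = k y x" if "x \<in> ?S" "y \<in> ?S" for x y
    using pd that by (simp add: positive_definite_kernel_def)
  have XS: "X $ i \<in> ?S" if "i < n" for i
    using X that by (auto simp: ordered_points_def less_imp_le)
  have dim: "dim_vec X = n" using X by (auto simp: ordered_points_def)
  have y: "?y \<in> ?S" "a < ?y" "?y < b" using X j(1) by (auto simp: ordered_points_def)
  have ZX: "Z ?y = X" using dim by (auto simp: Z_def intro!: eq_vecI)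
  have w: "w \<in> carrier_vec n"
    using bq_weights_system(1)[OF ordered_points_positive_definite[OF pd X]] dim by (simp add: w_def)
  define G where "G = (\<lambda>t. quadrature_variance \<nu> k (Z t) w)"
  have G: "G t = (LINT x|\<nu>. kernel_mean \<nu> k x)
    - 2 * (\<Sum>i<n. w $ i * kernel_mean \<nu> k (if i = j then t else X $ i))
    + (\<Sum>i<n. \<Sum>l<n. w $ i * w $ l * k (if l = j then t else X $ l) (if i = j then t else X $ i))" for t
    unfolding G_def using w by (subst quadrature_variance_sum) (auto simp: Z_def)
  have mean: "((\<lambda>t. kernel_mean \<nu> k (if i = j then t else X $ i)) has_real_derivative
      (if i = j then ?m else 0)) (at ?y within ?S)" for i
    using kernel_mean_derivative[OF ab k \<nu> y(1)] by simp
  have fst: "((\<lambda>t. k t x) has_real_derivative ?d x) (at ?y within ?S)" if x: "x \<in> ?S" for x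
    by (rule has_field_derivative_transform_within[where d = 1,
          OF smooth_kernel_partial_derivative[OF ab k x y(1)]])
      (use x y(1) sym in auto)
  have snd: "((\<lambda>t. k (if l = j then t else X $ l) (if i = j then t else X $ i)) has_real_derivative
      ((if i = j then ?d (X $ l) else 0) + (if l = j then ?d (X $ i) else 0))) (at ?y within ?S)"
    if "i < n" "l < n" for i l
    using kernel_diagonal_derivative[OF ab k sym y(1)] fst[OF XS[OF that(1)]]
      smooth_kernel_partial_derivative[OF ab k XS[OF that(2)] y(1)]
    by (cases "i = j"; cases "l = j") auto
  have "(G has_real_derivative 0 - 2 * (\<Sum>i<n. w $ i * (if i = j then ?m else 0))
      + (\<Sum>i<n. \<Sum>l<n. w $ i * w $ l * ((if i = j then ?d (X $ l) else 0) + (if l = j then ?d (X $ i) else 0))))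
    (at ?y within ?S)"
    unfolding G by (intro DERIV_add DERIV_diff DERIV_const DERIV_cmult DERIV_sum mean snd) auto
  also have "(\<Sum>i<n. w $ i * (if i = j then ?m else 0)) = w $ j * ?m"
    using j(1) by (simp add: if_distrib cong: if_cong)
  also have "(\<Sum>i<n. \<Sum>l<n. w $ i * w $ l * ((if i = j then ?d (X $ l) else 0) + (if l = j then ?d (X $ i) else 0)))
      = 2 * (w $ j * (\<Sum>i<n. w $ i * ?d (X $ i)))"
  proof -
    have "(\<Sum>i<n. \<Sum>l<n. w $ i * w $ l * (if i = j then ?d (X $ l) else 0))
        = (\<Sum>i<n. if i = j then w $ j * (\<Sum>l<n. w $ l * ?d (X $ l)) else 0)"
      by (intro sum.cong) (auto simp: sum_distrib_left mult.assoc)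
    moreover have "(\<Sum>i<n. \<Sum>l<n. w $ i * w $ l * (if l = j then ?d (X $ i) else 0))
        = (\<Sum>i<n. w $ j * (w $ i * ?d (X $ i)))"
      using j(1) by (intro sum.cong) (simp_all add: if_distrib cong: if_cong)
    ultimately show ?thesis
      using j(1) by (simp add: distrib_left sum.distrib sum_distrib_left)
  qed
  finally have "(G has_real_derivative 2 * (w $ j * ((\<Sum>i<n. w $ i * ?d (X $ i)) - ?m))) (at ?y)"
    using y(2,3) by (simp add: at_within_Icc_at algebra_simps)
  moreover have "((\<lambda>t. bq_variance \<nu> k (Z t)) has_real_derivative 0) (at ?y)"
    using opt j(1) dim by (simp add: locally_optimal_def Z_def)
  ultimately have deriv: "((\<lambda>t. G t - bq_variance \<nu> k (Z t)) has_real_derivative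
      2 * (w $ j * ((\<Sum>i<n. w $ i * ?d (X $ i)) - ?m)) - 0) (at ?y)"
    by (rule DERIV_diff)
  have "G ?y - bq_variance \<nu> k (Z ?y) = 0"
    using bq_variance_minimal(2)[OF ordered_points_positive_definite[OF pd X], of "0\<^sub>v n" \<nu>] dim
    by (simp add: G_def ZX w_def)
  moreover have "\<forall>\<^sub>F t in nhds ?y. 0 \<le> G t - bq_variance \<nu> k (Z t)"
    using eventually_ordered_points[OF X j(1)]
  proof eventually_elim
    case (elim t)
    then show ?case
      using bq_variance_minimal(1)[OF ordered_points_positive_definite[OF pd elim], of w \<nu>] w
      by (simp add: G_def Z_def)
  qed
  ultimately obtain e where "e > 0"
    "\<forall>t. \<bar>?y - t\<bar> < e \<longrightarrow> G ?y - bq_variance \<nu> k (Z ?y) \<le> G t - bq_variance \<nu> k (Z t)"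
    by (auto simp: eventually_nhds_metric dist_real_def abs_minus_commute)
  from DERIV_local_min[OF deriv this] j(2) show ?thesis
    by (simp add: w_def)
qed

section \<open>Positivity of the weights\<close>

theorem corollary1:
  fixes a b :: real
    and \<nu> :: "real measure"
    and k :: "real \<Rightarrow> real \<Rightarrow> real"
    and n :: nat
    and X :: "real vec"
  assumes "a < b"
    and "prob_space \<nu>"
    and "sets \<nu> = sets (restrict_space borel {a..b})"
    and "\<exists>p \<in> borel_measurable (restrict_space lborel {a..b}).
           \<nu> = density (restrict_space lborel {a..b}) p"
    and "smooth_kernel {a..b} k"
    and "positive_definite_kernel {a..b} k"
    and "totally_positive {a..b} 2 k"
    and "X \<in> ordered_points a b n"
    and "locally_optimal \<nu> k X"
  shows "\<forall>i<n. 0 < bq_weights \<nu> k X $ i"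
proof (intro allI impI)
  fix j assume j: "j < n"
  interpret prob_space \<nu> by fact
  note ab = assms(1) and \<nu> = assms(2,3) and k = assms(5) and pd = assms(6) and X = assms(8)
  note sp = borel_prob_space_Icc(1)[OF \<nu>] and int = borel_prob_space_Icc(2)[OF \<nu>]
  define w where "w = bq_weights \<nu> k X"
  \<comment> \<open>Local optimality says nothing about the derivative at a node of weight zero, so such a node
    is left out of \<open>Y\<close>; it does not contribute to the rule either.\<close>
  define Y where "Y = (\<lambda>i. X $ i) ` {i. i < n \<and> i \<noteq> j \<and> w $ i \<noteq> 0}"
  define I where "I = insert (X $ j, 0) (Y \<times> {..<2::nat})"
  define \<phi> where "\<phi> = (\<lambda>(y, l). kernel_deriv {a..b} k l y)"
  have dim: "dim_vec X = n" and XS: "\<And>i. i < n \<Longrightarrow> X $ i \<in> {a..b}"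
    using X by (auto simp: ordered_points_def less_imp_le)
  have distinct: "X $ i \<noteq> X $ l" if "i < n" "l < n" "i \<noteq> l" for i l
    using inj_onD[OF ordered_points_inj[OF X]] that by auto
  have Y: "finite Y" "Y \<subseteq> {a..b}" and z: "X $ j \<in> {a..b} - Y"
    using XS distinct j by (auto simp: Y_def)
  have "card I = 2 * card Y + 1"
    using Y(1) z by (simp add: I_def card_cartesian_product)
  moreover have "chebyshev_system {a..b} I \<phi>"
    unfolding I_def \<phi>_def by (rule totally_positive_chebyshev_system[OF assms(7) Y z])
  ultimately obtain c where c: "\<And>y. y \<in> Y \<Longrightarrow> (\<Sum>i\<in>I. c i * \<phi> i y) = 0"
    "\<And>x. x \<in> {a..b} - Y \<Longrightarrow> 0 < (\<Sum>i\<in>I. c i * \<phi> i x)"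
    using chebyshev_system_double_zeros[OF ab _ _ Y] by blast
  define f where "f = (\<lambda>x. \<Sum>i\<in>I. c i * \<phi> i x)"
  have int_\<phi>: "integrable \<nu> (\<phi> p)" if "p \<in> I" for p
    using that Y(2) z continuous_on_kernel_deriv[OF k] by (intro int) (auto simp: \<phi>_def I_def)
  then have int_f: "integrable \<nu> f"
    unfolding f_def by (intro Bochner_Integration.integrable_sum integrable_mult_right)
  \<comment> \<open>The quadrature rule integrates every function of the system exactly.\<close>
  have exact: "(LINT x|\<nu>. \<phi> p x) = (\<Sum>i<n. w $ i * \<phi> p (X $ i))" if p: "p \<in> I" for p
  proof -
    obtain i l where il: "p = (X $ i, l)" "i < n" "l = 0 \<or> l = 1 \<and> w $ i \<noteq> 0"
      using p j by (auto simp: I_def Y_def less_Suc_eq numeral_2_eq_2)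
    show ?thesis
    proof (cases "l = 0")
      case True
      have "(kernel_matrix k X *\<^sub>v w) $ i = kernel_mean_vec \<nu> k X $ i"
        using bq_weights_system(2)[OF ordered_points_positive_definite[OF pd X]] by (simp add: w_def)
      moreover have "w \<in> carrier_vec n"
        using bq_weights_system(1)[OF ordered_points_positive_definite[OF pd X]] dim by (simp add: w_def)
      ultimately show ?thesis
        using il True dim
        by (simp add: \<phi>_def kernel_deriv_def kernel_mean_vec_def kernel_mean_def kernel_matrix_def
            scalar_prod_def atLeast0LessThan mult.commute)
    next
      case False
      then show ?thesis
        using locally_optimal_derivative_exact[OF ab \<nu> k pd X assms(9) il(2)] il
        by (simp add: \<phi>_def w_def)
    qed
  qed
  have "(LINT x|\<nu>. f x) = (\<Sum>p\<in>I. c p * (LINT x|\<nu>. \<phi> p x))"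
    unfolding f_def using int_\<phi> by (subst Bochner_Integration.integral_sum) auto
  also have "\<dots> = (\<Sum>p\<in>I. \<Sum>i<n. w $ i * (c p * \<phi> p (X $ i)))"
    by (intro sum.cong) (simp_all add: exact sum_distrib_left ac_simps)
  also have "\<dots> = (\<Sum>i<n. w $ i * f (X $ i))"
    unfolding f_def sum_distrib_left by (rule sum.swap)
  \<comment> \<open>A node other than \<open>x\<^sub>j\<close> has weight zero or lies in \<open>Y\<close>, where \<open>f\<close> vanishes.\<close>
  also have "\<dots> = (\<Sum>i<n. if i = j then w $ j * f (X $ j) else 0)"
  proof (rule sum.cong)
    fix i assume "i \<in> {..<n}"
    then show "w $ i * f (X $ i) = (if i = j then w $ j * f (X $ j) else 0)"
      using c(1)[of "X $ i"] by (auto simp: Y_def f_def)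
  qed simp
  also have "\<dots> = w $ j * f (X $ j)" using j by simp
  finally have integral: "(LINT x|\<nu>. f x) = w $ j * f (X $ j)" .
  have nonneg: "AE x in \<nu>. 0 \<le> f x"
    using c by (intro AE_I2) (force simp: sp f_def)
  have "(LINT x|\<nu>. f x) \<noteq> 0"
  proof
    assume "(LINT x|\<nu>. f x) = 0"
    then have "AE x in \<nu>. f x = 0"
      using integral_nonneg_eq_0_iff_AE[OF int_f nonneg] by simp
    moreover have "AE x in \<nu>. x \<notin> Y"
      using assms(4) density_AE_notin_finite Y(1) by blast
    ultimately have "AE x in \<nu>. False"
      using AE_space by eventually_elim (use c(2) in \<open>force simp: sp f_def\<close>)
    then show False by simp
  qed
  with integral_nonneg_AE[OF nonneg] have "0 < (LINT x|\<nu>. f x)"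
    by (metis order_le_less)
  then have "0 < w $ j * f (X $ j)"
    unfolding integral .
  moreover have "0 < f (X $ j)" using c(2)[OF z] by (simp add: f_def)
  ultimately show "0 < bq_weights \<nu> k X $ j"
    by (simp add: w_def zero_less_mult_iff)
qed

end
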